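(* Let $G$ be a finite nilpotent group, let $p$ be a prime dividing $|G|$, and let $\chi\in\varUpsilon_p(G)$. Then $\chi$ is linear and either $\chi=1_G$ or $p=|G|_2=2$.
   Context: For a finite group $G$ and a prime $p$ dividing $|G|$, $\varSigma_p(G)$ is the set of $p$-singular elements of $G$, i.e. the elements whose order is divisible by $p$. A complex irreducible character $\chi$ of $G$ is $p$-constant if there is a constant $c_\chi$ with $\chi(g)=c_\chi$ for all $g\in\varSigma_p(G)$. $\varUpsilon_p(G)$ denotes the set of irreducible $p$-constant characters of $G$ of non-zero $p$-defect, equivalently the irreducible $p$-constant characters with $c_\chi\neq 0$. $|G|_2$ is the order of a Sylow $2$-subgroup of $G$, and $1_G$ is the principal character. Linear means of degree $1$. *)

theory Defs
  imports
    "HOL-Algebra.Multiplicative_Group"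
    "HOL-Algebra.Sylow"
    "HOL-Computational_Algebra.Primes"
    "Jordan_Normal_Form.VS_Connect"
begin

text \<open>
  The term \<open>upper_central G n\<close> is the \<open>n\<close>-th term of the upper central series: \<open>x\<close> is central
  modulo the normal subgroup \<open>Z\<close> iff all commutators of \<open>x\<close> with elements of \<open>G\<close> lie in \<open>Z\<close>.
\<close>

fun upper_central :: "('a, 'b) monoid_scheme \<Rightarrow> nat \<Rightarrow> 'a set" where
  "upper_central G 0 = {\<one>\<^bsub>G\<^esub>}"
| "upper_central G (Suc n) =
     {x \<in> carrier G. \<forall>y \<in> carrier G.
        x \<otimes>\<^bsub>G\<^esub> y \<otimes>\<^bsub>G\<^esub> inv\<^bsub>G\<^esub> x \<otimes>\<^bsub>G\<^esub> inv\<^bsub>G\<^esub> y \<in> upper_central G n}"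

definition nilpotent_group :: "('a, 'b) monoid_scheme \<Rightarrow> bool" where
  "nilpotent_group G \<longleftrightarrow> group G \<and> (\<exists>n. upper_central G n = carrier G)"

definition GL :: "nat \<Rightarrow> complex mat monoid" where
  "GL n = units_of (ring_mat TYPE(complex) n ())"

definition representation ::
    "('a, 'b) monoid_scheme \<Rightarrow> nat \<Rightarrow> ('a \<Rightarrow> complex mat) \<Rightarrow> bool" where
  "representation G n \<rho> \<longleftrightarrow> \<rho> \<in> hom G (GL n)"

definition invariant_subspace ::
    "('a, 'b) monoid_scheme \<Rightarrow> nat \<Rightarrow> ('a \<Rightarrow> complex mat) \<Rightarrow> complex vec set \<Rightarrow> bool" where
  "invariant_subspace G n \<rho> W \<longleftrightarrow>
     VectorSpace.subspace class_ring W (module_vec TYPE(complex) n) \<and>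
     (\<forall>g \<in> carrier G. \<forall>w \<in> W. \<rho> g *\<^sub>v w \<in> W)"

definition irreducible_representation ::
    "('a, 'b) monoid_scheme \<Rightarrow> nat \<Rightarrow> ('a \<Rightarrow> complex mat) \<Rightarrow> bool" where
  "irreducible_representation G n \<rho> \<longleftrightarrow>
     representation G n \<rho> \<and> n > 0 \<and>
     (\<forall>W. invariant_subspace G n \<rho> W \<longrightarrow> W = {0\<^sub>v n} \<or> W = carrier_vec n)"

definition mat_trace :: "complex mat \<Rightarrow> complex" where
  "mat_trace A = sum_list (diag_mat A)"

text \<open>
  Characters are extensional functions, i.e. \<^const>\<open>undefined\<close> outside the carrier, so that
  equality of characters is equality on the group.
\<close>

definition character_of ::
    "('a, 'b) monoid_scheme \<Rightarrow> ('a \<Rightarrow> complex mat) \<Rightarrow> 'a \<Rightarrow> complex" where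
  "character_of G \<rho> = (\<lambda>g \<in> carrier G. mat_trace (\<rho> g))"

definition irr_chars :: "('a, 'b) monoid_scheme \<Rightarrow> ('a \<Rightarrow> complex) set" where
  "irr_chars G = {character_of G \<rho> | \<rho> n. irreducible_representation G n \<rho>}"

definition principal_char :: "('a, 'b) monoid_scheme \<Rightarrow> 'a \<Rightarrow> complex" where
  "principal_char G = (\<lambda>g \<in> carrier G. 1)"

definition char_degree :: "('a, 'b) monoid_scheme \<Rightarrow> ('a \<Rightarrow> complex) \<Rightarrow> nat" where
  "char_degree G \<chi> = (THE n. \<chi> \<one>\<^bsub>G\<^esub> = of_nat n)"

definition linear_char :: "('a, 'b) monoid_scheme \<Rightarrow> ('a \<Rightarrow> complex) \<Rightarrow> bool" where
  "linear_char G \<chi> \<longleftrightarrow> char_degree G \<chi> = 1"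

definition p_singular :: "('a, 'b) monoid_scheme \<Rightarrow> nat \<Rightarrow> 'a set" where
  "p_singular G p = {g \<in> carrier G. p dvd group.ord G g}"

definition p_constant :: "('a, 'b) monoid_scheme \<Rightarrow> nat \<Rightarrow> ('a \<Rightarrow> complex) \<Rightarrow> bool" where
  "p_constant G p \<chi> \<longleftrightarrow> (\<exists>c. \<forall>g \<in> p_singular G p. \<chi> g = c)"

text \<open>
  The \<open>p\<close>-defect of \<open>\<chi>\<close> is the exponent of \<open>p\<close> in \<open>\<bar>G\<bar> / \<chi>(1)\<close>. The degree of an irreducible
  character divides the group order, so the subtraction does not truncate.
\<close>

definition p_defect :: "('a, 'b) monoid_scheme \<Rightarrow> nat \<Rightarrow> ('a \<Rightarrow> complex) \<Rightarrow> nat" where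
  "p_defect G p \<chi> = multiplicity p (Coset.order G) - multiplicity p (char_degree G \<chi>)"

definition Upsilon :: "('a, 'b) monoid_scheme \<Rightarrow> nat \<Rightarrow> ('a \<Rightarrow> complex) set" where
  "Upsilon G p = {\<chi> \<in> irr_chars G. p_constant G p \<chi> \<and> p_defect G p \<chi> \<noteq> 0}"

definition order_part :: "('a, 'b) monoid_scheme \<Rightarrow> nat \<Rightarrow> nat" where
  "order_part G p = p ^ multiplicity p (Coset.order G)"

lemma ex_subgroup_card_order_part:
  assumes "group G" "finite (carrier G)" "prime p"
  shows "\<exists>P. subgroup P G \<and> card P = order_part G p"
proof -
  obtain m where "Coset.order G = p ^ multiplicity p (Coset.order G) * m"
    using multiplicity_dvd[of p "Coset.order G"] by (auto elim: dvdE)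
  then show ?thesis
    using sylow_thm[OF \<open>prime p\<close> \<open>group G\<close> _ \<open>finite (carrier G)\<close>]
    by (simp add: order_part_def)
qed

end

theory Submission
  imports Defs "Jordan_Normal_Form.Spectral_Radius"
begin


text \<open>
  The centre of a nilpotent group of order divisible by \<open>p\<close> contains an element \<open>z\<close> of order \<open>p\<close>
  (\<open>nilpotent_ex_central_order_prime\<close>). By Schur's lemma \<open>z\<close> acts on an irreducible
  representation of degree \<open>n\<close> as a scalar \<open>\<omega>\<close>, so \<open>\<chi> (z g) = \<omega> \<chi> g\<close> for all \<open>g\<close>, and the
  constant value of \<open>\<chi>\<close> on \<open>p\<close>-singular elements is \<open>\<chi> z = \<omega> n\<close>.

  This determines \<open>\<chi>\<close>. The inverse of \<open>z\<close> is \<open>p\<close>-singular as well, which gives \<open>\<omega>\<^sup>2 = 1\<close>; for odd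
  \<open>p\<close> so is the square of \<open>z\<close>, which gives \<open>\<omega> = 1\<close>. If \<open>g\<close> is \<open>p\<close>-regular then \<open>z g\<close> is
  \<open>p\<close>-singular, whence \<open>\<omega> \<chi> g = \<omega> n\<close>. Thus \<open>\<chi>\<close> takes the value \<open>\<omega> n\<close> on \<open>p\<close>-singular and \<open>n\<close> on
  \<open>p\<close>-regular elements, with \<open>\<omega> = 1\<close> unless \<open>p = 2\<close> (\<open>p_constant_values\<close>).

  In particular \<open>\<chi> g * \<chi> (g\<inverse>) = n\<^sup>2\<close> for every \<open>g\<close>, while the sum of these products over the group
  is its order by the first orthogonality relation (\<open>sum_chi_chi_inv\<close>). Hence \<open>n = 1\<close>. If \<open>\<omega> = 1\<close>
  this makes \<open>\<chi>\<close> principal. Otherwise \<open>p = 2\<close> and \<open>\<omega> = -1\<close>. For a non-identity element \<open>s\<close> of a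
  Sylow 2-subgroup, \<open>\<chi> (z s) = - \<chi> s = n\<close>, so the 2-element \<open>z s\<close> is not 2-singular and must be the
  identity. The Sylow 2-subgroup therefore has just two elements (\<open>card_2_subgroup_le_2\<close>).
\<close>

section \<open>Central elements of prime order in nilpotent groups\<close>

context group
begin

definition commutator :: "'a \<Rightarrow> 'a \<Rightarrow> 'a" where
  "commutator x y = x \<otimes> y \<otimes> inv x \<otimes> inv y"

lemma commutator_closed [simp]:
  "x \<in> carrier G \<Longrightarrow> y \<in> carrier G \<Longrightarrow> commutator x y \<in> carrier G"
  by (simp add: commutator_def)

lemma mult_inv_cancel [simp]:
  assumes "x \<in> carrier G" "y \<in> carrier G"
  shows "x \<otimes> (inv x \<otimes> y) = y" "inv x \<otimes> (x \<otimes> y) = y"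
  using assms by (simp_all flip: m_assoc)

lemma upper_central_Suc:
  "upper_central G (Suc k) =
     {x \<in> carrier G. \<forall>y \<in> carrier G. commutator x y \<in> upper_central G k}"
  by (simp add: commutator_def)

lemma upper_central_subset: "upper_central G k \<subseteq> carrier G"
  by (cases k) auto

lemma commutator_mult_left:
  assumes "a \<in> carrier G" "b \<in> carrier G" "y \<in> carrier G"
  shows "commutator (a \<otimes> b) y = a \<otimes> commutator b y \<otimes> inv a \<otimes> commutator a y"
  using assms by (simp add: commutator_def m_assoc inv_mult_group)

lemma commutator_inv_left:
  assumes "a \<in> carrier G" "y \<in> carrier G"
  shows "commutator (inv a) y = inv a \<otimes> inv (commutator a y) \<otimes> a"
  using assms by (simp add: commutator_def m_assoc inv_mult_group)

lemma commutator_conj_left: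
  assumes "a \<in> carrier G" "g \<in> carrier G" "y \<in> carrier G"
  shows "commutator (g \<otimes> a \<otimes> inv g) y = g \<otimes> commutator a (inv g \<otimes> y \<otimes> g) \<otimes> inv g"
  using assms by (simp add: commutator_def m_assoc inv_mult_group)

lemma inv_commutator:
  assumes "x \<in> carrier G" "y \<in> carrier G"
  shows "inv (commutator x y) = commutator y x"
  using assms by (simp add: commutator_def m_assoc inv_mult_group)

text \<open>
  Normality has to be part of the induction: closure of a term under products and inverses rests on
  the previous term being closed under conjugation.
\<close>

lemma upper_central_normal: "upper_central G k \<lhd> G"
proof (induction k)
  case 0
  show ?case by (simp add: one_is_normal)
next
  case (Suc k)
  interpret Z: normal "upper_central G k" G by (rule Suc.IH)
  note [simp] = upper_central_Suc
  have "subgroup (upper_central G (Suc k)) G"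
  proof (rule subgroupI)
    have "\<one> \<in> upper_central G (Suc k)"
      by (simp del: upper_central.simps) (simp add: commutator_def Z.one_closed)
    then show "upper_central G (Suc k) \<noteq> {}" by blast
  next
    fix a assume "a \<in> upper_central G (Suc k)"
    then show "inv a \<in> upper_central G (Suc k)"
      by (simp del: upper_central.simps add: commutator_inv_left Z.inv_op_closed1 Z.m_inv_closed)
  next
    fix a b assume "a \<in> upper_central G (Suc k)" "b \<in> upper_central G (Suc k)"
    then show "a \<otimes> b \<in> upper_central G (Suc k)"
      by (simp del: upper_central.simps add: commutator_mult_left Z.inv_op_closed2 Z.m_closed)
  qed (rule upper_central_subset)
  moreover have "g \<otimes> a \<otimes> inv g \<in> upper_central G (Suc k)"
    if "g \<in> carrier G" "a \<in> upper_central G (Suc k)" for g a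
    using that
    by (simp del: upper_central.simps add: commutator_conj_left Z.inv_op_closed2)
  ultimately show ?case by (simp add: normal_inv_iff del: upper_central.simps upper_central_Suc)
qed

text \<open>
  Modulo the \<open>k\<close>-th term, commutators with elements of the \<open>(k+2)\<close>-nd term are central, so there
  \<open>x \<mapsto> [x, y]\<close> is a homomorphism and commutes with taking powers.
\<close>

lemma commutator_pow_mod_upper_central:
  fixes j :: nat
  assumes x: "x \<in> upper_central G (Suc (Suc k))" and y: "y \<in> carrier G"
  shows "\<exists>u \<in> upper_central G k. commutator (x [^] j) y = u \<otimes> commutator x y [^] j"
proof (induction j)
  case 0
  interpret Z: normal "upper_central G k" G by (rule upper_central_normal)
  show ?case using y Z.one_closed by (intro bexI[of _ \<one>]) (simp_all add: commutator_def)
next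
  case (Suc j)
  interpret Z: normal "upper_central G k" G by (rule upper_central_normal)
  interpret Z2: normal "upper_central G (Suc (Suc k))" G by (rule upper_central_normal)
  note [simp del] = upper_central.simps
  have xG: "x \<in> carrier G" using x by (rule Z2.mem_carrier)
  obtain u where u: "u \<in> upper_central G k" "commutator (x [^] j) y = u \<otimes> commutator x y [^] j"
    using Suc.IH by blast
  have uG: "u \<in> carrier G" using u(1) by (rule Z.mem_carrier)
  define d where "d = commutator (x [^] j) y"
  have dG: "d \<in> carrier G" unfolding d_def using xG y by simp
  have "x [^] j \<in> upper_central G (Suc (Suc k))"
    by (induction j) (use x Z2.one_closed Z2.m_closed in auto)
  then have "d \<in> upper_central G (Suc k)"
    unfolding d_def using y upper_central_Suc[of "Suc k"] by blast
  then have "commutator d x \<in> upper_central G k"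
    using xG upper_central_Suc[of k] by blast
  then have xd: "commutator x d \<in> upper_central G k"
    using Z.m_inv_closed inv_commutator[OF dG xG] by metis
  have "commutator (x [^] Suc j) y = commutator (x \<otimes> x [^] j) y"
    using xG by (simp add: nat_pow_Suc2[symmetric])
  also have "\<dots> = x \<otimes> d \<otimes> inv x \<otimes> commutator x y"
    using xG y by (simp add: commutator_mult_left d_def)
  also have "x \<otimes> d \<otimes> inv x = commutator x d \<otimes> d"
    using xG dG by (simp add: commutator_def m_assoc)
  also have "commutator x d \<otimes> d \<otimes> commutator x y
      = (commutator x d \<otimes> u) \<otimes> commutator x y [^] Suc j"
    using u(2) xG dG uG y by (simp add: d_def[symmetric] m_assoc)
  finally show ?case using Z.m_closed[OF xd u(1)] by blast
qed

text \<open>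
  An exponent of the centre annihilates every factor of the upper central series: if \<open>x\<close> lies in
  a term, then the commutators \<open>[x, y]\<close> lie one term lower, and by induction \<open>[x\<^sup>m, y]\<close>, which is
  \<open>[x, y]\<^sup>m\<close> up to a factor from below, lies another term lower.
\<close>

lemma pow_mem_upper_central:
  fixes m :: nat
  assumes exp: "\<And>z. z \<in> upper_central G 1 \<Longrightarrow> z [^] m = \<one>"
    and x: "x \<in> upper_central G (Suc k)"
  shows "x [^] m \<in> upper_central G k"
  using x
proof (induction k arbitrary: x)
  case 0
  then show ?case using exp by simp
next
  case (Suc k)
  interpret Z: normal "upper_central G k" G by (rule upper_central_normal)
  note [simp del] = upper_central.simps
  have xG: "x \<in> carrier G" using Suc.prems upper_central_subset by blast
  have "commutator (x [^] m) y \<in> upper_central G k" if y: "y \<in> carrier G" for y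
  proof -
    have "commutator x y \<in> upper_central G (Suc k)"
      using Suc.prems y upper_central_Suc[of "Suc k"] by blast
    then have "commutator x y [^] m \<in> upper_central G k" by (rule Suc.IH)
    then show ?thesis
      using commutator_pow_mod_upper_central[OF Suc.prems y, of m] Z.m_closed by auto
  qed
  then show ?case using xG by (simp add: upper_central_Suc)
qed

lemma pow_exponent_upper_central:
  fixes m :: nat
  assumes exp: "\<And>z. z \<in> upper_central G 1 \<Longrightarrow> z [^] m = \<one>"
    and x: "x \<in> upper_central G k"
  shows "x [^] (m ^ k) = \<one>"
  using x
proof (induction k arbitrary: x)
  case 0
  then show ?case by simp
next
  case (Suc k)
  have xG: "x \<in> carrier G" using Suc.prems upper_central_subset by blast
  have "(x [^] m) [^] (m ^ k) = \<one>"
    by (rule Suc.IH[OF pow_mem_upper_central[OF exp Suc.prems]])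
  then show ?case using xG by (simp add: nat_pow_pow)
qed

lemma upper_central_1_commutes:
  assumes z: "z \<in> upper_central G 1" and g: "g \<in> carrier G"
  shows "z \<otimes> g = g \<otimes> z"
proof -
  have zG: "z \<in> carrier G" using z upper_central_subset by blast
  have "z \<otimes> g \<otimes> inv z \<otimes> inv g = \<one>" using z g by simp
  then have "z \<otimes> g \<otimes> inv z = g" using zG g inv_equality inv_inv by (metis inv_closed m_closed)
  then show ?thesis using zG g by (metis inv_solve_right m_closed)
qed

lemma subgroup_pow_card:
  assumes P: "subgroup P G" and x: "x \<in> P"
  shows "x [^] card P = \<one>"
proof -
  have "x [^]\<^bsub>G\<lparr>carrier := P\<rparr>\<^esub> Coset.order (G\<lparr>carrier := P\<rparr>) = \<one>"
    using group.pow_order_eq_1[OF subgroup.subgroup_is_group[OF P group_axioms]] x by simp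
  then show ?thesis by (simp add: nat_pow_consistent[symmetric] Coset.order_def)
qed

lemma ex_prime_power_order_elem:
  assumes fin: "finite (carrier G)" and p: "prime (p::nat)" "p dvd Coset.order G"
  shows "\<exists>x \<in> carrier G. \<exists>a. x \<noteq> \<one> \<and> x [^] (p ^ a) = \<one>"
proof -
  obtain P where P: "subgroup P G" "card P = order_part G p"
    using ex_subgroup_card_order_part[OF group_axioms fin p(1)] by blast
  have "Coset.order G \<noteq> 0" using fin by (simp add: order_gt_0_iff_finite[symmetric])
  then have "multiplicity p (Coset.order G) > 0"
    using p by (simp add: prime_multiplicity_gt_zero_iff)
  then have "card P > 1"
    using P(2) one_less_power[OF prime_gt_1_nat[OF p(1)]] by (simp add: order_part_def)
  then have "\<not> P \<subseteq> {\<one>}" using card_mono[of "{\<one>}" P] by auto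
  then obtain x where x: "x \<in> P" "x \<noteq> \<one>" by blast
  then show ?thesis
    using subgroup_pow_card[OF P(1) x(1)] P(2) subgroup.mem_carrier[OF P(1)]
    by (auto simp: order_part_def)
qed

text \<open>
  The product \<open>m\<close> of the orders of the central elements is an exponent of the centre, so a power of
  \<open>m\<close> is an exponent of the whole group. As the group has non-trivial elements of \<open>p\<close>-power order,
  \<open>p\<close> divides \<open>m\<close>, hence the order of some central element, and a power of that element has
  order \<open>p\<close>.
\<close>

lemma nilpotent_ex_central_order_prime:
  assumes nil: "nilpotent_group G" and fin: "finite (carrier G)"
    and p: "prime (p::nat)" "p dvd Coset.order G"
  shows "\<exists>z \<in> upper_central G 1. ord z = p"
proof -
  interpret Z: normal "upper_central G 1" G by (rule upper_central_normal)
  have finZ: "finite (upper_central G 1)"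
    using fin upper_central_subset finite_subset by blast
  define m where "m = (\<Prod>z \<in> upper_central G 1. ord z)"
  have exp: "z [^] m = \<one>" if "z \<in> upper_central G 1" for z
  proof -
    have "ord z dvd m" unfolding m_def using that finZ by (rule dvd_prodI[rotated])
    then show ?thesis using that Z.mem_carrier pow_eq_id by blast
  qed
  obtain k where k: "upper_central G k = carrier G"
    using nil by (auto simp: nilpotent_group_def)
  obtain x a where x: "x \<in> carrier G" "x \<noteq> \<one>" "x [^] (p ^ a) = \<one>"
    using ex_prime_power_order_elem[OF fin p] by blast
  have "x \<in> upper_central G k" unfolding k by (rule x(1))
  with exp have "x [^] (m ^ k) = \<one>" by (rule pow_exponent_upper_central)
  then have "ord x dvd m ^ k" using pow_eq_id[OF x(1)] by blast
  moreover have "ord x dvd p ^ a" using pow_eq_id[OF x(1)] x(3) by blast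
  moreover have "ord x \<noteq> 1" using x ord_eq_1 by blast
  ultimately have "\<not> coprime (p ^ a) (m ^ k)"
    unfolding coprime_def by auto
  then have "\<not> coprime p m" by auto
  then have "p dvd m" using prime_imp_coprime[OF p(1)] by blast
  then obtain z where z: "z \<in> upper_central G 1" "p dvd ord z"
    unfolding m_def using prime_dvd_prod_iff[OF finZ p(1)] by blast
  have zG: "z \<in> carrier G" using z(1) by (rule Z.mem_carrier)
  have pos: "ord z > 0" using ord_ge_1[OF fin zG] by simp
  obtain q where q: "ord z = q * p" using z(2) by (metis dvdE mult.commute)
  have "z [^] j \<in> upper_central G 1" for j :: nat
    by (induction j) (use z(1) Z.one_closed Z.m_closed in \<open>auto simp del: upper_central.simps One_nat_def\<close>)
  moreover have "ord (z [^] q) = p"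
    using ord_pow[OF zG, of q] q pos by simp
  ultimately show ?thesis by blast
qed

text \<open>
  If \<open>k\<close> annihilates both \<open>z g\<close> and \<open>g\<close>, it annihilates \<open>z\<close>. Applied to the product of the orders
  of \<open>z g\<close> and \<open>g\<close>, this puts the prime factor \<open>p\<close> into the order of \<open>z g\<close>.
\<close>

lemma ord_central_mult_regular:
  assumes p: "prime (p::nat)" and z: "z \<in> carrier G" "ord z = p" and comm: "z \<otimes> g = g \<otimes> z"
    and g: "g \<in> carrier G" and reg: "\<not> p dvd ord g"
  shows "p dvd ord (z \<otimes> g)"
proof -
  define k where "k = ord (z \<otimes> g) * ord g"
  have zg: "z \<otimes> g \<in> carrier G" using z(1) g by simp
  have "(z \<otimes> g) [^] k = \<one>" using pow_eq_id[OF zg] by (simp add: k_def)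
  moreover have "g [^] k = \<one>" using pow_eq_id[OF g] by (simp add: k_def)
  ultimately have "z [^] k = \<one>" using pow_mult_distrib[OF comm z(1) g] z(1) by simp
  then have "p dvd ord (z \<otimes> g) * ord g" using pow_eq_id[OF z(1)] z(2) k_def by simp
  then show ?thesis using p reg by (simp add: prime_dvd_mult_iff)
qed

end

section \<open>Schur's lemma and the first orthogonality relation\<close>

lemma mat_trace_sum: "A \<in> carrier_mat n n \<Longrightarrow> mat_trace A = (\<Sum>i<n. A $$ (i, i))"
  by (auto simp: mat_trace_def diag_mat_def interv_sum_list_conv_sum_set_nat atLeast0LessThan)

lemma mat_trace_smult:
  "A \<in> carrier_mat n n \<Longrightarrow> mat_trace (c \<cdot>\<^sub>m A) = c * mat_trace A"
  by (auto simp: mat_trace_sum[of _ n] sum_distrib_left)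

lemma mat_mult_entry:
  "A \<in> carrier_mat n n \<Longrightarrow> B \<in> carrier_mat n n \<Longrightarrow> i < n \<Longrightarrow> j < n
    \<Longrightarrow> (A * B) $$ (i, j) = (\<Sum>k<n. A $$ (i, k) * B $$ (k, j))"
  by (auto simp: scalar_prod_def atLeast0LessThan)

locale finite_group_irrep = group G for G :: "('a, 'b) monoid_scheme" (structure) +
  fixes n :: nat and \<rho> :: "'a \<Rightarrow> complex mat"
  assumes finite_carrier: "finite (carrier G)"
    and irreducible: "irreducible_representation G n \<rho>"
begin

abbreviation \<chi> :: "'a \<Rightarrow> complex" where
  "\<chi> \<equiv> character_of G \<rho>"

lemma degree_pos: "n > 0"
  using irreducible by (simp add: irreducible_representation_def)

lemma rho_hom: "\<rho> \<in> hom G (GL n)"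
  using irreducible by (simp add: irreducible_representation_def representation_def)

lemma rho_carrier [simp]: "g \<in> carrier G \<Longrightarrow> \<rho> g \<in> carrier_mat n n"
  using hom_in_carrier[OF rho_hom, of g]
  by (auto simp: GL_def units_of_carrier Units_def ring_mat_simps)

lemma rho_mult: "g \<in> carrier G \<Longrightarrow> h \<in> carrier G \<Longrightarrow> \<rho> (g \<otimes> h) = \<rho> g * \<rho> h"
  using hom_mult[OF rho_hom] by (simp add: GL_def units_of_mult ring_mat_simps)

lemma rho_one: "\<rho> \<one> = 1\<^sub>m n"
proof -
  interpret R: ring "ring_mat TYPE(complex) n ()" by (rule ring_mat)
  have "group (GL n)" unfolding GL_def by (rule R.units_group)
  then show ?thesis
    using hom_one[OF rho_hom group_axioms] by (simp add: GL_def units_of_one ring_mat_simps)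
qed

lemma chi_trace: "g \<in> carrier G \<Longrightarrow> \<chi> g = (\<Sum>i<n. \<rho> g $$ (i, i))"
  by (simp add: character_of_def mat_trace_sum[OF rho_carrier])

lemma chi_one: "\<chi> \<one> = of_nat n"
  by (simp add: chi_trace rho_one)

lemma char_degree_eq: "char_degree G \<chi> = n"
  by (simp add: char_degree_def chi_one)

lemma rho_entry_mult:
  assumes "g \<in> carrier G" "h \<in> carrier G" "i < n" "j < n"
  shows "\<rho> (g \<otimes> h) $$ (i, j) = (\<Sum>k<n. \<rho> g $$ (i, k) * \<rho> h $$ (k, j))"
  using assms by (simp add: rho_mult mat_mult_entry)

text \<open>
  An eigenspace of a matrix commuting with the representation is invariant. It is non-zero, so
  irreducibility makes it the whole space.
\<close>

lemma schur_scalar: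
  assumes A: "A \<in> carrier_mat n n"
    and comm: "\<And>g. g \<in> carrier G \<Longrightarrow> A * \<rho> g = \<rho> g * A"
  obtains c where "A = c \<cdot>\<^sub>m 1\<^sub>m n"
proof -
  obtain c where "c \<in> spectrum A" using spectrum_non_empty[OF A degree_pos] by blast
  then obtain w where w: "w \<in> carrier_vec n" "w \<noteq> 0\<^sub>v n" "A *\<^sub>v w = c \<cdot>\<^sub>v w"
    using A by (auto simp: spectrum_def eigenvalue_def eigenvector_def)
  define W where "W = {v \<in> carrier_vec n. A *\<^sub>v v = c \<cdot>\<^sub>v v}"
  have "submodule class_ring W (module_vec TYPE(complex) n)"
    by (rule submodule.intro[OF vec_module])
       (use A in \<open>auto simp: W_def module_vec_simps mult_add_distrib_mat_vec
        smult_add_distrib_vec mult_mat_vec smult_smult_assoc mult.commute\<close>)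
  then have "VectorSpace.subspace class_ring W (module_vec TYPE(complex) n)"
    by (simp add: VectorSpace.subspace_def vec_vs)
  moreover have "\<rho> g *\<^sub>v v \<in> W" if g: "g \<in> carrier G" and v: "v \<in> W" for g v
  proof -
    note r = rho_carrier[OF g]
    have vc: "v \<in> carrier_vec n" "A *\<^sub>v v = c \<cdot>\<^sub>v v" using v by (auto simp: W_def)
    have "A *\<^sub>v (\<rho> g *\<^sub>v v) = \<rho> g *\<^sub>v (A *\<^sub>v v)"
      using A r vc(1) comm[OF g] by (metis assoc_mult_mat_vec)
    also have "\<dots> = c \<cdot>\<^sub>v (\<rho> g *\<^sub>v v)" using r vc by (simp add: mult_mat_vec)
    finally show ?thesis using r vc by (simp add: W_def)
  qed
  ultimately have "W = {0\<^sub>v n} \<or> W = carrier_vec n"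
    using irreducible
    by (simp add: irreducible_representation_def invariant_subspace_def)
  moreover have "w \<in> W" using w by (simp add: W_def)
  ultimately have W: "W = carrier_vec n" using w(2) by blast
  have "A = c \<cdot>\<^sub>m 1\<^sub>m n"
  proof (rule eq_matI)
    fix i j assume "i < dim_row (c \<cdot>\<^sub>m 1\<^sub>m n)" "j < dim_col (c \<cdot>\<^sub>m 1\<^sub>m n)"
    then have ij: "i < n" "j < n" by auto
    have "unit_vec n j \<in> W" unfolding W by simp
    then have "A *\<^sub>v unit_vec n j = c \<cdot>\<^sub>v unit_vec n j" by (simp add: W_def)
    then have "(A *\<^sub>v unit_vec n j) $ i = (c \<cdot>\<^sub>v unit_vec n j) $ i" by simp
    then show "A $$ (i, j) = (c \<cdot>\<^sub>m 1\<^sub>m n) $$ (i, j)" using A ij by simp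
  qed (use A in auto)
  then show ?thesis by (rule that)
qed

lemma central_chi_mult:
  assumes z: "z \<in> carrier G" and central: "\<And>g. g \<in> carrier G \<Longrightarrow> z \<otimes> g = g \<otimes> z"
  obtains \<omega> where "\<And>g. g \<in> carrier G \<Longrightarrow> \<chi> (z \<otimes> g) = \<omega> * \<chi> g"
proof -
  have "\<rho> z * \<rho> g = \<rho> g * \<rho> z" if "g \<in> carrier G" for g
    using that z central by (metis rho_mult)
  then obtain \<omega> where \<omega>: "\<rho> z = \<omega> \<cdot>\<^sub>m 1\<^sub>m n"
    using schur_scalar[OF rho_carrier[OF z]] by blast
  have "\<chi> (z \<otimes> g) = \<omega> * \<chi> g" if g: "g \<in> carrier G" for g
  proof -
    have "\<rho> (z \<otimes> g) = \<omega> \<cdot>\<^sub>m \<rho> g"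
      using mult_smult_assoc_mat[OF one_carrier_mat rho_carrier[OF g]] rho_carrier[OF g]
      by (simp add: rho_mult[OF z g] \<omega>)
    then show ?thesis using z g by (simp add: character_of_def mat_trace_smult[OF rho_carrier])
  qed
  then show ?thesis by (rule that)
qed

text \<open>
  Summing the conjugates of the matrix unit at \<open>(i, j)\<close> gives a matrix \<open>M\<close> commuting with the
  representation. By Schur's lemma \<open>M\<close> is a scalar, which its trace identifies; the claim is the
  entry of \<open>M\<close> at \<open>(i, j)\<close>.
\<close>

lemma sum_entries_orthogonal:
  assumes i: "i < n" and j: "j < n"
  shows "(\<Sum>g\<in>carrier G. \<rho> g $$ (i, i) * \<rho> (inv g) $$ (j, j))
      = (if i = j then of_nat (Coset.order G) / of_nat n else 0)"
proof -
  define M where "M = mat n n (\<lambda>(a, b). \<Sum>g\<in>carrier G. \<rho> g $$ (a, i) * \<rho> (inv g) $$ (j, b))"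
  have M: "M \<in> carrier_mat n n" by (simp add: M_def)
  have "M * \<rho> h = \<rho> h * M" if h: "h \<in> carrier G" for h
  proof (rule eq_matI)
    fix a b assume "a < dim_row (\<rho> h * M)" "b < dim_col (\<rho> h * M)"
    then have ab: "a < n" "b < n" using rho_carrier[OF h] M by auto
    have "(M * \<rho> h) $$ (a, b) = (\<Sum>k<n. M $$ (a, k) * \<rho> h $$ (k, b))"
      using ab M h by (simp add: mat_mult_entry)
    also have "\<dots> = (\<Sum>k<n. \<Sum>g\<in>carrier G. \<rho> g $$ (a, i) * (\<rho> (inv g) $$ (j, k) * \<rho> h $$ (k, b)))"
      using ab by (simp add: M_def sum_distrib_right mult.assoc)
    also have "\<dots> = (\<Sum>g\<in>carrier G. \<rho> g $$ (a, i) * \<rho> (inv g \<otimes> h) $$ (j, b))"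
      using ab j h by (subst sum.swap) (simp add: rho_entry_mult sum_distrib_left)
    \<comment> \<open>The substitution \<open>g \<mapsto> h g\<close> moves \<open>h\<close> from the second factor to the first.\<close>
    also have "\<dots> = (\<Sum>g\<in>carrier G. \<rho> (h \<otimes> g) $$ (a, i) * \<rho> (inv g) $$ (j, b))"
      by (rule sum.reindex_bij_witness[of _ "\<lambda>g. h \<otimes> g" "\<lambda>g. inv h \<otimes> g"])
         (use h in \<open>simp_all add: inv_mult_group\<close>)
    also have "\<dots> = (\<Sum>k<n. \<Sum>g\<in>carrier G. \<rho> h $$ (a, k) * (\<rho> g $$ (k, i) * \<rho> (inv g) $$ (j, b)))"
      using ab i h by (subst sum.swap) (simp add: rho_entry_mult sum_distrib_right mult.assoc)
    also have "\<dots> = (\<Sum>k<n. \<rho> h $$ (a, k) * M $$ (k, b))"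
      using ab by (simp add: M_def sum_distrib_left)
    also have "\<dots> = (\<rho> h * M) $$ (a, b)"
      by (rule mat_mult_entry[OF rho_carrier[OF h] M ab, symmetric])
    finally show "(M * \<rho> h) $$ (a, b) = (\<rho> h * M) $$ (a, b)" .
  qed (use rho_carrier[OF h] M in auto)
  then obtain c where c: "M = c \<cdot>\<^sub>m 1\<^sub>m n" using schur_scalar[OF M] by blast
  have "of_nat n * c = (\<Sum>a<n. M $$ (a, a))" by (simp add: c)
  also have "\<dots> = (\<Sum>g\<in>carrier G. \<Sum>a<n. \<rho> (inv g) $$ (j, a) * \<rho> g $$ (a, i))"
    by (subst sum.swap) (simp add: M_def mult.commute)
  also have "\<dots> = (\<Sum>g\<in>carrier G. \<rho> (inv g \<otimes> g) $$ (j, i))"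
    using i j by (intro sum.cong refl) (simp only: rho_entry_mult inv_closed)
  also have "\<dots> = (if i = j then of_nat (Coset.order G) else 0)"
    using i j by (simp add: rho_one Coset.order_def)
  finally have "c = (if i = j then of_nat (Coset.order G) / of_nat n else 0)"
    using degree_pos by (auto simp: field_simps split: if_splits)
  moreover have "M $$ (i, j) = (if i = j then c else 0)" using i j by (simp add: c)
  ultimately show ?thesis using i j by (simp add: M_def)
qed

lemma sum_chi_chi_inv:
  "(\<Sum>g\<in>carrier G. \<chi> g * \<chi> (inv g)) = of_nat (Coset.order G)"
proof -
  have "(\<Sum>g\<in>carrier G. \<chi> g * \<chi> (inv g))
      = (\<Sum>g\<in>carrier G. \<Sum>i<n. \<Sum>j<n. \<rho> g $$ (i, i) * \<rho> (inv g) $$ (j, j))"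
    by (intro sum.cong refl) (simp add: chi_trace sum_product)
  also have "\<dots> = (\<Sum>i<n. \<Sum>j<n. \<Sum>g\<in>carrier G. \<rho> g $$ (i, i) * \<rho> (inv g) $$ (j, j))"
    by (subst sum.swap, intro sum.cong refl, rule sum.swap)
  also have "\<dots> = (\<Sum>i<n. \<Sum>j<n. if i = j then of_nat (Coset.order G) / of_nat n else 0)"
    by (intro sum.cong refl) (simp add: sum_entries_orthogonal)
  also have "\<dots> = of_nat (Coset.order G)"
    using degree_pos by (simp add: sum.delta)
  finally show ?thesis .
qed

text \<open>
  If all terms of the orthogonality relation equal \<open>n\<^sup>2\<close>, their sum is both \<open>n\<^sup>2\<close> times the group
  order and the group order itself.
\<close>

lemma degree_eq_1:
  assumes "\<And>g. g \<in> carrier G \<Longrightarrow> \<chi> g * \<chi> (inv g) = (of_nat n)\<^sup>2"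
  shows "n = 1"
proof -
  have "of_nat (Coset.order G) * (of_nat n)\<^sup>2 = (of_nat (Coset.order G) :: complex)"
    using sum_chi_chi_inv assms by (simp add: Coset.order_def)
  moreover have "Coset.order G \<noteq> 0"
    using finite_carrier order_gt_0_iff_finite by simp
  ultimately have "(of_nat (n\<^sup>2) :: complex) = of_nat 1" by simp
  then have "n\<^sup>2 = 1" by (simp only: of_nat_eq_iff)
  then show ?thesis by simp
qed

section \<open>Characters that are constant on p-singular elements\<close>

text \<open>
  The scalar \<open>\<omega>\<close> by which \<open>z\<close> acts is pinned down by evaluating \<open>\<chi>\<close> at the \<open>p\<close>-singular elements
  \<open>z\<close>, \<open>z\<inverse>\<close> and, for odd \<open>p\<close>, \<open>z\<^sup>2\<close>. Multiplication by \<open>z\<close> turns \<open>p\<close>-regular elements into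
  \<open>p\<close>-singular ones and thus transfers the constant value to them.
\<close>

lemma p_constant_values:
  assumes p: "prime p"
    and z: "z \<in> carrier G" "ord z = p" and central: "\<And>g. g \<in> carrier G \<Longrightarrow> z \<otimes> g = g \<otimes> z"
    and const: "\<And>g. g \<in> p_singular G p \<Longrightarrow> \<chi> g = c"
  obtains \<omega> where "\<omega>\<^sup>2 = 1" "p \<noteq> 2 \<Longrightarrow> \<omega> = 1"
    "\<And>g. g \<in> carrier G \<Longrightarrow> \<chi> (z \<otimes> g) = \<omega> * \<chi> g"
    "\<And>g. g \<in> carrier G \<Longrightarrow> \<chi> g = (if g \<in> p_singular G p then \<omega> else 1) * of_nat n"
proof -
  obtain \<omega> where \<omega>: "\<And>g. g \<in> carrier G \<Longrightarrow> \<chi> (z \<otimes> g) = \<omega> * \<chi> g"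
    using central_chi_mult[OF z(1) central] by blast
  have "z \<in> p_singular G p" "inv z \<in> p_singular G p"
    using z by (simp_all add: p_singular_def)
  then have c: "\<chi> z = c" "\<chi> (inv z) = c" using const by blast+
  have c_eq: "c = \<omega> * of_nat n" using \<omega>[of \<one>] z(1) c(1) by (simp add: chi_one)
  have "of_nat n = \<omega> * c" using \<omega>[of "inv z"] z(1) c(2) by (simp add: chi_one)
  then have sq: "\<omega>\<^sup>2 = 1" using c_eq degree_pos by (simp add: power2_eq_square)
  have odd: "\<omega> = 1" if "p \<noteq> 2"
  proof -
    have "\<not> p dvd 2" using that primes_dvd_imp_eq[OF p two_is_prime_nat] by blast
    then have "z [^] (2::nat) \<noteq> \<one>" using pow_eq_id[OF z(1)] z(2) by blast
    then have "ord (z \<otimes> z) \<noteq> 1"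
      using ord_eq_1[of "z \<otimes> z"] z(1) by (simp add: numeral_2_eq_2)
    moreover have "(z \<otimes> z) [^] p = \<one>"
      using pow_mult_distrib[of z z p] pow_ord_eq_1[OF z(1)] z by simp
    then have "ord (z \<otimes> z) dvd p" using pow_eq_id[of "z \<otimes> z"] z(1) by blast
    ultimately have "ord (z \<otimes> z) = p" using p prime_nat_iff by blast
    then have "\<chi> (z \<otimes> z) = c" using const z(1) by (simp add: p_singular_def)
    then have "c = \<omega> * c" using \<omega>[OF z(1)] c(1) by simp
    moreover have "c \<noteq> 0" using c_eq sq degree_pos by auto
    ultimately show ?thesis by simp
  qed
  have "\<chi> g = (if g \<in> p_singular G p then \<omega> else 1) * of_nat n" if g: "g \<in> carrier G" for g
  proof (cases "g \<in> p_singular G p")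
    case True
    then show ?thesis using const c_eq by simp
  next
    case False
    then have "z \<otimes> g \<in> p_singular G p"
      using ord_central_mult_regular[OF p z central[OF g] g] g z(1) by (simp add: p_singular_def)
    then have "\<omega> * \<chi> g = \<omega> * of_nat n" using const \<omega>[OF g] c_eq by metis
    then show ?thesis using False sq by auto
  qed
  then show ?thesis using that sq odd \<omega> by blast
qed

text \<open>
  A non-identity element \<open>s\<close> of a 2-subgroup is 2-singular, so \<open>\<chi> s = -n\<close> and \<open>\<chi> (z s) = n\<close>. Then
  \<open>z s\<close> is a 2-element that is not 2-singular, hence trivial, which leaves only \<open>s = z\<inverse>\<close>.
\<close>

lemma card_2_subgroup_le_2:
  assumes z: "z \<in> carrier G" "ord z = 2" and central: "\<And>g. g \<in> carrier G \<Longrightarrow> z \<otimes> g = g \<otimes> z"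
    and sign: "\<And>g. g \<in> carrier G \<Longrightarrow> \<chi> (z \<otimes> g) = - \<chi> g"
    and val: "\<And>g. g \<in> carrier G \<Longrightarrow> \<chi> g = (if g \<in> p_singular G 2 then - 1 else 1) * of_nat n"
    and S: "subgroup S G" "card S = 2 ^ a"
  shows "card S \<le> 2"
proof -
  have "s = inv z" if s: "s \<in> S" "s \<noteq> \<one>" for s
  proof -
    have sG: "s \<in> carrier G" using S(1) s(1) by (rule subgroup.mem_carrier)
    have s_pow: "s [^] (2 ^ a :: nat) = \<one>" using subgroup_pow_card[OF S(1) s(1)] S(2) by simp
    have two_elt: "g = \<one> \<or> g \<in> p_singular G 2"
      if g: "g \<in> carrier G" "g [^] (2 ^ b :: nat) = \<one>" for g b
    proof -
      have "ord g dvd 2 ^ b" using g pow_eq_id by blast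
      then obtain i where "ord g = 2 ^ i" using divides_primepow_nat[OF two_is_prime_nat] by blast
      then show ?thesis using g(1) ord_eq_1[OF g(1)] by (cases i) (auto simp: p_singular_def)
    qed
    have "\<chi> s = - of_nat n" using two_elt[OF sG s_pow] s(2) val[OF sG] by auto
    then have "\<chi> (z \<otimes> s) = of_nat n" using sign[OF sG] by simp
    then have "z \<otimes> s \<notin> p_singular G 2" using val[of "z \<otimes> s"] sG z(1) degree_pos by auto
    moreover have "(z \<otimes> s) [^] (2 ^ Suc a :: nat) = \<one>"
    proof -
      have "z [^] (2 ^ Suc a :: nat) = \<one>" using pow_eq_id[OF z(1)] z(2) by simp
      moreover have "s [^] (2 ^ Suc a :: nat) = (s [^] (2 ^ a :: nat)) [^] (2::nat)"
        using sG by (simp add: nat_pow_pow mult.commute)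
      ultimately show ?thesis
        using pow_mult_distrib[OF central[OF sG] z(1) sG] s_pow by simp
    qed
    ultimately have "z \<otimes> s = \<one>" using two_elt sG z(1) by blast
    then show ?thesis using sG z(1) by (metis central inv_equality)
  qed
  then have "S \<subseteq> {\<one>, inv z}" by blast
  then have "card S \<le> card {\<one>, inv z}" by (rule card_mono[rotated]) simp
  also have "\<dots> \<le> 2" by (simp add: card_insert_if)
  finally show ?thesis .
qed

end

theorem corollary2p6:
  fixes G :: "('a, 'b) monoid_scheme" and p :: nat and \<chi> :: "'a \<Rightarrow> complex"
  assumes "group G" and "finite (carrier G)" and "nilpotent_group G"
    and "prime p" and "p dvd Coset.order G"
    and "\<chi> \<in> Upsilon G p"
  shows "linear_char G \<chi> \<and>
    (\<chi> = principal_char G \<or> (p = order_part G 2 \<and> order_part G 2 = 2))"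
proof -
  obtain \<rho> n where irr: "irreducible_representation G n \<rho>" and \<chi>: "\<chi> = character_of G \<rho>"
    using assms(6) by (auto simp: Upsilon_def irr_chars_def)
  interpret finite_group_irrep G n \<rho>
    using assms(1,2) irr by (simp add: finite_group_irrep_def finite_group_irrep_axioms_def)
  obtain c where c: "\<And>g. g \<in> p_singular G p \<Longrightarrow> character_of G \<rho> g = c"
    using assms(6) \<chi> by (auto simp: Upsilon_def p_constant_def)
  obtain z where zZ: "z \<in> upper_central G 1" and z_ord: "group.ord G z = p"
    using nilpotent_ex_central_order_prime[OF assms(3,2,4,5)] by blast
  have z: "z \<in> carrier G" using zZ upper_central_subset by blast
  note central = upper_central_1_commutes[OF zZ]
  obtain \<omega> where sq: "\<omega>\<^sup>2 = 1" and odd: "p \<noteq> 2 \<Longrightarrow> \<omega> = 1"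
    and mult: "\<And>g. g \<in> carrier G \<Longrightarrow> character_of G \<rho> (z \<otimes>\<^bsub>G\<^esub> g) = \<omega> * character_of G \<rho> g"
    and val: "\<And>g. g \<in> carrier G \<Longrightarrow>
      character_of G \<rho> g = (if g \<in> p_singular G p then \<omega> else 1) * of_nat n"
    using p_constant_values[OF assms(4) z z_ord central c] by blast
  have "character_of G \<rho> g * character_of G \<rho> (inv\<^bsub>G\<^esub> g) = (of_nat n)\<^sup>2"
    if g: "g \<in> carrier G" for g
  proof -
    have "inv\<^bsub>G\<^esub> g \<in> p_singular G p \<longleftrightarrow> g \<in> p_singular G p"
      using g by (simp add: p_singular_def)
    then show ?thesis using val[OF g] val[of "inv\<^bsub>G\<^esub> g"] g sq by (auto simp: power2_eq_square)
  qed
  then have n: "n = 1" by (rule degree_eq_1)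
  then have "linear_char G \<chi>" by (simp add: linear_char_def \<chi> char_degree_eq)
  moreover have "\<chi> = principal_char G \<or> (p = order_part G 2 \<and> order_part G 2 = 2)"
  proof (cases "\<omega> = 1")
    case True
    have "\<chi> g = principal_char G g" for g
      using val[of g] True n by (cases "g \<in> carrier G") (simp_all add: \<chi> principal_char_def character_of_def)
    then show ?thesis by blast
  next
    case False
    then have p2: "p = 2" and w: "\<omega> = - 1" using odd sq by (auto simp: power2_eq_1_iff)
    obtain S where S: "subgroup S G" "card S = order_part G 2"
      using ex_subgroup_card_order_part[OF assms(1,2) two_is_prime_nat] by blast
    have "card S \<le> 2"
      using card_2_subgroup_le_2[OF z _ central _ _ S(1), of "multiplicity 2 (Coset.order G)"]
        mult val S(2) z_ord p2 w by (simp add: order_part_def)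
    moreover have "Coset.order G \<noteq> 0"
      using assms(2) order_gt_0_iff_finite by simp
    then have "multiplicity 2 (Coset.order G) > 0"
      using assms(5) p2 by (simp add: prime_multiplicity_gt_zero_iff)
    then have "2 \<le> order_part G 2"
      using self_le_power[of "2::nat"] by (simp add: order_part_def)
    ultimately show ?thesis using S(2) p2 by simp
  qed
  ultimately show ?thesis by blast
qed

end
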